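(* Let $\mathbf{I}\mathbb{N}_{\infty}$ be the monoid of all partial cofinite isometries of $\mathbb{N}$ and let $\mathfrak{C}_{\mathbf{mg}}$ be its least group congruence. The quotient semigroup $\mathbf{I}\mathbb{N}_{\infty}/\mathfrak{C}_{\mathbf{mg}}$ is isomorphic to the additive group of integers $(\mathbb{Z},+)$.
   Context: $\mathbb{N}=\{1,2,3,\ldots\}$ with the metric $d(n,m)=|n-m|$. $\mathbf{I}\mathbb{N}_{\infty}$ is the inverse monoid of all partial maps $\alpha:\mathbb{N}\rightharpoonup\mathbb{N}$ such that $\mathbb{N}\setminus\operatorname{dom}\alpha$ and $\mathbb{N}\setminus\operatorname{ran}\alpha$ are finite and $|(x)\alpha-(y)\alpha|=|x-y|$ for all $x,y\in\operatorname{dom}\alpha$, with composition written left to right: $(x)(\alpha\beta)=((x)\alpha)\beta$, $\operatorname{dom}(\alpha\beta)=\{x\in\operatorname{dom}\alpha:(x)\alpha\in\operatorname{dom}\beta\}$. The least group congruence $\mathfrak{C}_{\mathbf{mg}}$ on an inverse semigroup $S$ is defined by: $s\,\mathfrak{C}_{\mathbf{mg}}\,t$ if and only if there exists an idempotent $e\in S$ such that $es=et$. *)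

theory Defs
  imports "HOL-Algebra.Elementary_Groups"
begin

(* The set of positive integers is {1..} :: nat set; a partial map has type nat \<rightharpoonup> nat with
   domain and range inside {1..}, so it is undefined at 0. *)

definition cofinite_isometries :: "(nat \<rightharpoonup> nat) set" where
  "cofinite_isometries =
     {\<alpha>. dom \<alpha> \<subseteq> {1..} \<and> ran \<alpha> \<subseteq> {1..} \<and>
         finite ({1..} - dom \<alpha>) \<and> finite ({1..} - ran \<alpha>) \<and>
         (\<forall>x\<in>dom \<alpha>. \<forall>y\<in>dom \<alpha>.
            \<bar>int (the (\<alpha> x)) - int (the (\<alpha> y))\<bar> = \<bar>int x - int y\<bar>)}"

(* Maps act on the right, so the product of \<alpha> and \<beta> applies \<alpha> first. *)
definition IN_infinity :: "(nat \<rightharpoonup> nat) monoid" where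
  "IN_infinity =
     \<lparr>carrier = cofinite_isometries, monoid.mult = (\<lambda>\<alpha> \<beta>. \<beta> \<circ>\<^sub>m \<alpha>), one = Some |` {1..}\<rparr>"

definition least_group_congruence :: "('a, 'b) monoid_scheme \<Rightarrow> ('a \<times> 'a) set" where
  "least_group_congruence S =
     {(s, t). s \<in> carrier S \<and> t \<in> carrier S \<and>
        (\<exists>e\<in>carrier S. e \<otimes>\<^bsub>S\<^esub> e = e \<and> e \<otimes>\<^bsub>S\<^esub> s = e \<otimes>\<^bsub>S\<^esub> t)}"

(* If r is a congruence on S, the union below is the single class of x \<otimes> y, for any
   representatives x of A and y of B: see mult_quotient_monoid. *)
definition quotient_monoid :: "('a, 'b) monoid_scheme \<Rightarrow> ('a \<times> 'a) set \<Rightarrow> 'a set monoid" where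
  "quotient_monoid S r =
     \<lparr>carrier = carrier S // r,
      monoid.mult = (\<lambda>A B. \<Union>x\<in>A. \<Union>y\<in>B. r `` {x \<otimes>\<^bsub>S\<^esub> y}),
      one = r `` {\<one>\<^bsub>S\<^esub>}\<rparr>"

lemma mult_quotient_monoid:
  assumes "equiv (carrier S) r"
    and "congruent2 r r (\<lambda>x y. r `` {x \<otimes>\<^bsub>S\<^esub> y})"
    and "x \<in> carrier S" "y \<in> carrier S"
  shows "r `` {x} \<otimes>\<^bsub>quotient_monoid S r\<^esub> r `` {y} = r `` {x \<otimes>\<^bsub>S\<^esub> y}"
  using UN_equiv_class2[OF assms(1,1,2,3,4)] by (simp add: quotient_monoid_def)

lemma cofinite_isometriesD:
  assumes "\<alpha> \<in> cofinite_isometries"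
  shows "\<And>x y. \<alpha> x = Some y \<Longrightarrow> 1 \<le> x \<and> 1 \<le> y"
    and "finite ({1..} - dom \<alpha>)" and "finite ({1..} - ran \<alpha>)"
    and "\<And>x y u v. \<alpha> x = Some u \<Longrightarrow> \<alpha> y = Some v \<Longrightarrow> \<bar>int u - int v\<bar> = \<bar>int x - int y\<bar>"
proof -
  have D: "dom \<alpha> \<subseteq> {1..}" "ran \<alpha> \<subseteq> {1..}"
    and F: "finite ({1..} - dom \<alpha>)" "finite ({1..} - ran \<alpha>)"
    and I: "\<forall>x\<in>dom \<alpha>. \<forall>y\<in>dom \<alpha>.
          \<bar>int (the (\<alpha> x)) - int (the (\<alpha> y))\<bar> = \<bar>int x - int y\<bar>"
    using assms unfolding cofinite_isometries_def mem_Collect_eq by iprover+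
  show "finite ({1..} - dom \<alpha>)" "finite ({1..} - ran \<alpha>)" by (fact F)+
  show "1 \<le> x \<and> 1 \<le> y" if "\<alpha> x = Some y" for x y
    using D subsetD[OF D(1) domI[of \<alpha> x y, OF that]] subsetD[OF D(2) ranI[of \<alpha> x y, OF that]]
    by simp
  show "\<bar>int u - int v\<bar> = \<bar>int x - int y\<bar>" if "\<alpha> x = Some u" "\<alpha> y = Some v" for x y u v
    using bspec[OF bspec[OF I domI[of \<alpha> x u, OF that(1)]] domI[of \<alpha> y v, OF that(2)]] that
    by simp
qed

lemma cofinite_isometriesI:
  assumes "\<And>x y. \<alpha> x = Some y \<Longrightarrow> 1 \<le> x \<and> 1 \<le> y"
    and "finite ({1..} - dom \<alpha>)" and "finite ({1..} - ran \<alpha>)"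
    and "\<And>x y u v. \<alpha> x = Some u \<Longrightarrow> \<alpha> y = Some v \<Longrightarrow> \<bar>int u - int v\<bar> = \<bar>int x - int y\<bar>"
  shows "\<alpha> \<in> cofinite_isometries"
  using assms by (fastforce simp: cofinite_isometries_def ran_def)

lemma cofinite_isometries_inj:
  assumes "\<alpha> \<in> cofinite_isometries" "\<alpha> x = Some u" "\<alpha> y = Some u"
  shows "x = y"
  using cofinite_isometriesD(4)[OF assms] by simp

lemma finite_bad_preimage:
  assumes "\<alpha> \<in> cofinite_isometries" "finite B"
  shows "finite {x \<in> dom \<alpha>. the (\<alpha> x) \<in> B}"
proof (rule finite_imageD)
  show "finite ((\<lambda>x. the (\<alpha> x)) ` {x \<in> dom \<alpha>. the (\<alpha> x) \<in> B})"
    by (rule finite_subset[OF _ assms(2)]) auto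
  show "inj_on (\<lambda>x. the (\<alpha> x)) {x \<in> dom \<alpha>. the (\<alpha> x) \<in> B}"
  proof (rule inj_onI)
    fix x y
    assume "x \<in> {x \<in> dom \<alpha>. the (\<alpha> x) \<in> B}" "y \<in> {x \<in> dom \<alpha>. the (\<alpha> x) \<in> B}"
      and eq: "the (\<alpha> x) = the (\<alpha> y)"
    then obtain u v where "\<alpha> x = Some u" "\<alpha> y = Some v" by blast
    then show "x = y" using eq cofinite_isometries_inj[OF assms(1), of x u y] by simp
  qed
qed

lemma cofinite_isometries_comp:
  assumes a: "\<alpha> \<in> cofinite_isometries" and b: "\<beta> \<in> cofinite_isometries"
  shows "\<beta> \<circ>\<^sub>m \<alpha> \<in> cofinite_isometries"
proof (rule cofinite_isometriesI)
  show "1 \<le> x \<and> 1 \<le> y" if "(\<beta> \<circ>\<^sub>m \<alpha>) x = Some y" for x y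
    using that cofinite_isometriesD(1)[OF a] cofinite_isometriesD(1)[OF b]
    by (auto simp: map_comp_Some_iff)
  show "\<bar>int u - int v\<bar> = \<bar>int x - int y\<bar>"
    if "(\<beta> \<circ>\<^sub>m \<alpha>) x = Some u" "(\<beta> \<circ>\<^sub>m \<alpha>) y = Some v" for x y u v
  proof -
    obtain x' y' where "\<alpha> x = Some x'" "\<beta> x' = Some u" "\<alpha> y = Some y'" "\<beta> y' = Some v"
      using \<open>(\<beta> \<circ>\<^sub>m \<alpha>) x = Some u\<close> \<open>(\<beta> \<circ>\<^sub>m \<alpha>) y = Some v\<close> by (auto simp: map_comp_Some_iff)
    then show ?thesis
      using cofinite_isometriesD(4)[OF a, of x x' y y'] cofinite_isometriesD(4)[OF b, of x' u y' v]
      by simp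
  qed
  have "{1..} - dom (\<beta> \<circ>\<^sub>m \<alpha>) \<subseteq> ({1..} - dom \<alpha>) \<union> {x \<in> dom \<alpha>. the (\<alpha> x) \<in> {1..} - dom \<beta>}"
    using cofinite_isometriesD(1)[OF a] by (auto simp: map_comp_def)
  then show "finite ({1..} - dom (\<beta> \<circ>\<^sub>m \<alpha>))"
    using finite_bad_preimage[OF a cofinite_isometriesD(2)[OF b]] cofinite_isometriesD(2)[OF a]
    by (meson finite_UnI finite_subset)
  have "{1..} - ran (\<beta> \<circ>\<^sub>m \<alpha>) \<subseteq> ({1..} - ran \<beta>) \<union> (\<lambda>x. the (\<beta> x)) ` ({1..} - ran \<alpha>)"
  proof
    fix z assume z: "z \<in> {1..} - ran (\<beta> \<circ>\<^sub>m \<alpha>)"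
    show "z \<in> ({1..} - ran \<beta>) \<union> (\<lambda>x. the (\<beta> x)) ` ({1..} - ran \<alpha>)"
    proof (cases "z \<in> ran \<beta>")
      case True
      then obtain y where y: "\<beta> y = Some z" by (auto simp: ran_def)
      have "y \<notin> ran \<alpha>"
      proof
        assume "y \<in> ran \<alpha>"
        then obtain x where "\<alpha> x = Some y" by (auto simp: ran_def)
        then have "(\<beta> \<circ>\<^sub>m \<alpha>) x = Some z" using y by simp
        then show False using z by (auto simp: ran_def)
      qed
      then have "y \<in> {1..} - ran \<alpha>" using cofinite_isometriesD(1)[OF b y] by simp
      then show ?thesis using y by (metis UnI2 image_eqI option.sel)
    qed (use z in auto)
  qed
  then show "finite ({1..} - ran (\<beta> \<circ>\<^sub>m \<alpha>))"
    using cofinite_isometriesD(3)[OF a] cofinite_isometriesD(3)[OF b]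
    by (meson finite_UnI finite_imageI finite_subset)
qed

lemma partial_identity:
  assumes "A \<subseteq> {1..}" "finite ({1..} - A)"
  shows "Some |` A \<in> cofinite_isometries"
proof -
  have "dom (Some |` A) = A" "ran (Some |` A) = A"
    by (auto simp: ran_def restrict_map_def split: if_splits)
  then show ?thesis
    using assms by (intro cofinite_isometriesI) (auto simp: restrict_map_def split: if_splits)
qed

lemma comp_partial_identity: "\<alpha> \<circ>\<^sub>m (Some |` A) = \<alpha> |` A"
  by (auto simp: map_comp_def restrict_map_def)

lemma idempotent_partial_identity:
  assumes e: "e \<in> cofinite_isometries" and "e \<circ>\<^sub>m e = e"
  shows "e = Some |` dom e"
proof
  fix x
  show "e x = (Some |` dom e) x"
  proof (cases "e x")
    case (Some y)
    then have "(e \<circ>\<^sub>m e) x = Some y" by (simp add: assms(2))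
    then have "e y = Some y" using Some by (simp add: map_comp_Some_iff)
    then have "x = y" using cofinite_isometries_inj[OF e Some] by simp
    then show ?thesis using Some by (simp add: restrict_map_def dom_def)
  qed (simp add: restrict_map_def dom_def)
qed

lemma monoid_IN_infinity: "monoid IN_infinity"
proof (rule monoidI)
  show "\<one>\<^bsub>IN_infinity\<^esub> \<in> carrier IN_infinity"
    by (simp add: IN_infinity_def partial_identity)
next
  fix x assume "x \<in> carrier IN_infinity"
  then have x: "x \<in> cofinite_isometries" by (simp add: IN_infinity_def)
  have pos: "1 \<le> n \<and> 1 \<le> m" if "x n = Some m" for n m
    using cofinite_isometriesD(1)[OF x that] .
  show "\<one>\<^bsub>IN_infinity\<^esub> \<otimes>\<^bsub>IN_infinity\<^esub> x = x"
  proof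
    fix n
    show "(\<one>\<^bsub>IN_infinity\<^esub> \<otimes>\<^bsub>IN_infinity\<^esub> x) n = x n"
      using pos[of n]
      by (cases "x n") (simp_all add: IN_infinity_def map_comp_def restrict_map_def)
  qed
  show "x \<otimes>\<^bsub>IN_infinity\<^esub> \<one>\<^bsub>IN_infinity\<^esub> = x"
  proof
    fix n
    show "(x \<otimes>\<^bsub>IN_infinity\<^esub> \<one>\<^bsub>IN_infinity\<^esub>) n = x n"
      using pos[of n]
      by (cases "x n") (simp_all add: IN_infinity_def map_comp_def restrict_map_def)
  qed
next
  fix x y z
  show "x \<otimes>\<^bsub>IN_infinity\<^esub> y \<otimes>\<^bsub>IN_infinity\<^esub> z = x \<otimes>\<^bsub>IN_infinity\<^esub> (y \<otimes>\<^bsub>IN_infinity\<^esub> z)"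
    by (simp add: IN_infinity_def map_comp_def fun_eq_iff split: option.split)
qed (simp add: IN_infinity_def cofinite_isometries_comp)

lemma least_group_congruence_IN_infinity_iff:
  "(s, t) \<in> least_group_congruence IN_infinity \<longleftrightarrow>
     s \<in> cofinite_isometries \<and> t \<in> cofinite_isometries \<and>
     (\<exists>A. A \<subseteq> {1..} \<and> finite ({1..} - A) \<and> s |` A = t |` A)"
  (is "?l \<longleftrightarrow> ?r")
proof
  assume ?l
  then obtain e where e: "e \<in> cofinite_isometries" "e \<circ>\<^sub>m e = e" "s \<circ>\<^sub>m e = t \<circ>\<^sub>m e"
    and st: "s \<in> cofinite_isometries" "t \<in> cofinite_isometries"
    by (auto simp: least_group_congruence_def IN_infinity_def)
  have "s |` dom e = t |` dom e"
    using e(3) idempotent_partial_identity[OF e(1,2)] by (metis comp_partial_identity)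
  moreover have "dom e \<subseteq> {1..}" "finite ({1..} - dom e)"
    using e(1) by (auto simp: cofinite_isometries_def)
  ultimately show ?r using st by blast
next
  assume ?r
  then obtain A where A: "A \<subseteq> {1..}" "finite ({1..} - A)" "s |` A = t |` A"
    and st: "s \<in> cofinite_isometries" "t \<in> cofinite_isometries" by blast
  show ?l
    unfolding least_group_congruence_def IN_infinity_def
    using st A partial_identity[OF A(1,2)]
    by (auto simp: comp_partial_identity intro!: bexI[of _ "Some |` A"])
qed

lemma equiv_least_group_congruence:
  "equiv (carrier IN_infinity) (least_group_congruence IN_infinity)"
proof (rule equivI)
  show "least_group_congruence IN_infinity \<subseteq> carrier IN_infinity \<times> carrier IN_infinity"
    by (auto simp: least_group_congruence_def)
  show "refl_on (carrier IN_infinity) (least_group_congruence IN_infinity)"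
  proof (rule refl_onI)
    fix s assume "s \<in> carrier IN_infinity"
    then have "s \<in> cofinite_isometries" by (simp add: IN_infinity_def)
    then show "(s, s) \<in> least_group_congruence IN_infinity"
      unfolding least_group_congruence_IN_infinity_iff by (auto intro!: exI[of _ "{1..}"])
  qed
  show "sym (least_group_congruence IN_infinity)"
  proof (rule symI)
    fix s t assume "(s, t) \<in> least_group_congruence IN_infinity"
    then show "(t, s) \<in> least_group_congruence IN_infinity"
      unfolding least_group_congruence_IN_infinity_iff by metis
  qed
  show "trans (least_group_congruence IN_infinity)"
  proof (rule transI)
    fix s t u
    assume "(s, t) \<in> least_group_congruence IN_infinity"
      and "(t, u) \<in> least_group_congruence IN_infinity"
    then obtain A B where A: "A \<subseteq> {1..}" "finite ({1..} - A)" "s |` A = t |` A"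
      and B: "finite ({1..} - B)" "t |` B = u |` B"
      and su: "s \<in> cofinite_isometries" "u \<in> cofinite_isometries"
      unfolding least_group_congruence_IN_infinity_iff by blast
    have "s |` (A \<inter> B) = u |` (A \<inter> B)"
    proof
      fix x
      show "(s |` (A \<inter> B)) x = (u |` (A \<inter> B)) x"
        using fun_cong[OF A(3), of x] fun_cong[OF B(2), of x]
        by (cases "x \<in> A"; cases "x \<in> B") (simp_all add: restrict_map_def)
    qed
    moreover have "finite ({1..} - A \<inter> B)" using A(2) B(1) by (simp add: Diff_Int)
    ultimately show "(s, u) \<in> least_group_congruence IN_infinity"
      using su A(1) unfolding least_group_congruence_IN_infinity_iff
      by (intro conjI exI[of _ "A \<inter> B"]) auto
  qed
qed

lemma congruent2_least_group_congruence:
  defines "r \<equiv> least_group_congruence IN_infinity"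
  shows "congruent2 r r (\<lambda>x y. r `` {x \<otimes>\<^bsub>IN_infinity\<^esub> y})"
proof (rule congruent2I[OF equiv_least_group_congruence[folded r_def]
      equiv_least_group_congruence[folded r_def]])
  note iff = least_group_congruence_IN_infinity_iff[folded r_def]
  note eq = equiv_class_eq[OF equiv_least_group_congruence[folded r_def]]
  fix s t u assume u: "u \<in> carrier IN_infinity" and st: "(s, t) \<in> r"
  have u': "u \<in> cofinite_isometries" using u by (simp add: IN_infinity_def)
  obtain A where A: "A \<subseteq> {1..}" "finite ({1..} - A)" "s |` A = t |` A"
    and s: "s \<in> cofinite_isometries" and t: "t \<in> cofinite_isometries"
    using st unfolding iff by blast
  have At: "s x = t x" if "x \<in> A" for x using fun_cong[OF A(3), of x] that by simp
  show "r `` {s \<otimes>\<^bsub>IN_infinity\<^esub> u} = r `` {t \<otimes>\<^bsub>IN_infinity\<^esub> u}"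
  proof (rule eq)
    have "(u \<circ>\<^sub>m s) |` A = (u \<circ>\<^sub>m t) |` A"
      using At by (auto simp: restrict_map_def map_comp_def)
    then show "(s \<otimes>\<^bsub>IN_infinity\<^esub> u, t \<otimes>\<^bsub>IN_infinity\<^esub> u) \<in> r"
      using A(1,2) cofinite_isometries_comp[OF s u'] cofinite_isometries_comp[OF t u']
      by (auto simp: iff IN_infinity_def)
  qed
  show "r `` {u \<otimes>\<^bsub>IN_infinity\<^esub> s} = r `` {u \<otimes>\<^bsub>IN_infinity\<^esub> t}"
  proof (rule eq)
    define B where "B = {x \<in> dom u. the (u x) \<in> A}"
    have "{1..} - B \<subseteq> ({1..} - dom u) \<union> {x \<in> dom u. the (u x) \<in> {1..} - A}"
      using cofinite_isometriesD(1)[OF u'] by (auto simp: B_def)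
    then have "finite ({1..} - B)"
      using finite_bad_preimage[OF u' A(2)] cofinite_isometriesD(2)[OF u']
      by (meson finite_UnI finite_subset)
    moreover have "B \<subseteq> {1..}" using cofinite_isometriesD(1)[OF u'] by (auto simp: B_def)
    moreover have "(s \<circ>\<^sub>m u) |` B = (t \<circ>\<^sub>m u) |` B"
      using At by (auto simp: restrict_map_def map_comp_def B_def fun_eq_iff split: option.split)
    ultimately show "(u \<otimes>\<^bsub>IN_infinity\<^esub> s, u \<otimes>\<^bsub>IN_infinity\<^esub> t) \<in> r"
      using cofinite_isometries_comp[OF u' s] cofinite_isometries_comp[OF u' t]
      by (auto simp: iff IN_infinity_def)
  qed
qed

lemmas mult_quotient_IN_infinity =
  mult_quotient_monoid[OF equiv_least_group_congruence congruent2_least_group_congruence]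

end

theory Submission
  imports Defs
begin

text \<open>
  A cofinite isometry of the positive integers cannot reflect. Compared with a sufficiently large
  point of the domain, the reflected image would be negative, so every point is moved by
  the same integer as that large point. Hence each \<open>\<alpha>\<close> is a restriction of the translation by one
  integer, its displacement (\<open>cofinite_isometry_translation\<close>).

  Displacements add under composition, every integer is the displacement of a partial translation,
  and two maps with the same displacement agree on the intersection of their domains, which is
  cofinite. Since congruent maps share a value, the least group congruence is therefore equality
  of displacements (\<open>least_group_congruence_iff_displacement\<close>), so displacement induces an
  isomorphism from the quotient onto the integers.
\<close>

definition displacement :: "(nat \<rightharpoonup> nat) \<Rightarrow> int" where
  "displacement \<alpha> = (THE k. \<exists>x y. \<alpha> x = Some y \<and> k = int y - int x)"

lemma cofinite_pos_unbounded:
  assumes "finite ({1..} - A)"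
  shows "\<exists>z\<in>A. (n::nat) < z"
proof (rule ccontr)
  assume "\<not> (\<exists>z\<in>A. n < z)"
  then have "{Suc n..} \<subseteq> {1..} - A" by auto
  then show False using assms infinite_Ici finite_subset by blast
qed

text \<open>
  Both points are compared with a common point \<open>z\<close> of the domain which lies so far out that
  the image of \<open>z\<close> has to lie to the right of both images.
\<close>

lemma cofinite_isometry_translation:
  assumes a: "\<alpha> \<in> cofinite_isometries" and x: "\<alpha> x = Some u" and y: "\<alpha> y = Some v"
  shows "int u - int x = int v - int y"
proof -
  obtain z where "z \<in> dom \<alpha>" and z: "x + u + y + v < z"
    using cofinite_pos_unbounded[OF cofinite_isometriesD(2)[OF a]] by blast
  then obtain w where w: "\<alpha> z = Some w" by blast
  have "int w - int z = int u - int x"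
    using cofinite_isometriesD(4)[OF a w x] z by linarith
  moreover have "int w - int z = int v - int y"
    using cofinite_isometriesD(4)[OF a w y] z by linarith
  ultimately show ?thesis by simp
qed

lemma displacement_eq:
  assumes "\<alpha> \<in> cofinite_isometries" "\<alpha> x = Some y"
  shows "displacement \<alpha> = int y - int x"
  unfolding displacement_def
  using assms cofinite_isometry_translation[OF assms(1)] by (intro the_equality) blast+

lemma cofinite_isometry_meets_cofinite:
  assumes "\<alpha> \<in> cofinite_isometries" "finite ({1..} - A)"
  obtains x y where "x \<in> A" "\<alpha> x = Some y"
proof -
  have "finite ({1..} - A \<inter> dom \<alpha>)"
    using assms(2) cofinite_isometriesD(2)[OF assms(1)] by (simp add: Diff_Int)
  then show ?thesis using cofinite_pos_unbounded[of "A \<inter> dom \<alpha>" 0] that by blast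
qed

lemma displacement_comp:
  assumes a: "\<alpha> \<in> cofinite_isometries" and b: "\<beta> \<in> cofinite_isometries"
  shows "displacement (\<beta> \<circ>\<^sub>m \<alpha>) = displacement \<alpha> + displacement \<beta>"
proof -
  note c = cofinite_isometries_comp[OF a b]
  obtain x z where xz: "(\<beta> \<circ>\<^sub>m \<alpha>) x = Some z"
    using cofinite_isometry_meets_cofinite[OF c, of UNIV] by (metis Diff_UNIV finite.emptyI)
  then obtain y where "\<alpha> x = Some y" "\<beta> y = Some z" by (auto simp: map_comp_Some_iff)
  then show ?thesis
    using displacement_eq[OF c xz] displacement_eq[OF a, of x y] displacement_eq[OF b, of y z]
    by simp
qed

lemma displacement_surj:
  obtains \<alpha> where "\<alpha> \<in> cofinite_isometries" "displacement \<alpha> = k"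
proof
  define \<alpha> where "\<alpha> x = (if 1 \<le> x \<and> 1 \<le> int x + k then Some (nat (int x + k)) else None)" for x
  have "{1..} - dom \<alpha> \<subseteq> {..nat (- k)}"
    by (auto simp: \<alpha>_def dom_def)
  then have fin_dom: "finite ({1..} - dom \<alpha>)" by (rule finite_subset) simp
  have "y \<in> ran \<alpha>" if "1 \<le> y" "nat k < y" for y
    using that by (intro ranI[of \<alpha> "nat (int y - k)"]) (auto simp: \<alpha>_def)
  then have "{1..} - ran \<alpha> \<subseteq> {..nat k}" by (meson DiffE atLeast_iff atMost_iff not_less subsetI)
  then have fin_ran: "finite ({1..} - ran \<alpha>)" by (rule finite_subset) simp
  show a: "\<alpha> \<in> cofinite_isometries"
    by (rule cofinite_isometriesI[OF _ fin_dom fin_ran]) (auto simp: \<alpha>_def split: if_splits)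
  obtain x y where xy: "\<alpha> x = Some y"
    using cofinite_isometry_meets_cofinite[OF a, of UNIV] by (metis Diff_UNIV finite.emptyI)
  then have "int y = int x + k" by (auto simp: \<alpha>_def split: if_splits)
  then show "displacement \<alpha> = k" using displacement_eq[OF a xy] by simp
qed

text \<open>
  Congruent maps share a value, which fixes the displacement. Conversely, a displacement
  determines the value at each point where the map is defined, so the idempotent witnessing the
  congruence can be taken to be the identity of the common domain.
\<close>

lemma least_group_congruence_iff_displacement:
  assumes s: "s \<in> cofinite_isometries" and t: "t \<in> cofinite_isometries"
  shows "(s, t) \<in> least_group_congruence IN_infinity \<longleftrightarrow> displacement s = displacement t"
proof
  assume "(s, t) \<in> least_group_congruence IN_infinity"
  then obtain A where A: "finite ({1..} - A)" "s |` A = t |` A"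
    unfolding least_group_congruence_IN_infinity_iff by blast
  obtain x y where xy: "x \<in> A" "s x = Some y"
    using cofinite_isometry_meets_cofinite[OF s A(1)] .
  then have "t x = Some y" using fun_cong[OF A(2), of x] by simp
  then show "displacement s = displacement t"
    using displacement_eq[OF s xy(2)] displacement_eq[OF t] by simp
next
  assume eq: "displacement s = displacement t"
  let ?A = "dom s \<inter> dom t"
  have "s x = t x" if "x \<in> ?A" for x
  proof -
    obtain u v where "s x = Some u" "t x = Some v" using \<open>x \<in> ?A\<close> by blast
    then show ?thesis using displacement_eq[OF s] displacement_eq[OF t] eq by fastforce
  qed
  then have "s |` ?A = t |` ?A" by (auto simp: restrict_map_def)
  moreover have "?A \<subseteq> {1..}" using s by (auto simp: cofinite_isometries_def)
  moreover have "finite ({1..} - ?A)"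
    using cofinite_isometriesD(2)[OF s] cofinite_isometriesD(2)[OF t] by (simp add: Diff_Int)
  ultimately show "(s, t) \<in> least_group_congruence IN_infinity"
    using s t unfolding least_group_congruence_IN_infinity_iff by blast
qed

lemma displacement_class:
  assumes "s \<in> cofinite_isometries"
  shows "the_elem (displacement ` (least_group_congruence IN_infinity `` {s})) = displacement s"
proof -
  have mem: "s \<in> least_group_congruence IN_infinity `` {s}"
    using assms by (simp add: least_group_congruence_iff_displacement)
  have "displacement t = displacement s" if "t \<in> least_group_congruence IN_infinity `` {s}" for t
    using that least_group_congruence_iff_displacement[OF assms, of t]
    by (auto simp: least_group_congruence_IN_infinity_iff)
  then have "displacement ` (least_group_congruence IN_infinity `` {s}) = {displacement s}"
    using mem by blast
  then show ?thesis by simp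
qed

theorem mainTheorem5:
  shows "quotient_monoid IN_infinity (least_group_congruence IN_infinity) \<cong> integer_group"
proof -
  let ?r = "least_group_congruence IN_infinity"
  let ?Q = "quotient_monoid IN_infinity ?r"
  define h where "h A = the_elem (displacement ` A)" for A
  have carrier: "carrier IN_infinity = cofinite_isometries" by (simp add: IN_infinity_def)
  have h: "h (?r `` {s}) = displacement s" if "s \<in> cofinite_isometries" for s
    using displacement_class[OF that] by (simp add: h_def)
  have Q: "\<exists>s\<in>cofinite_isometries. A = ?r `` {s}" if "A \<in> carrier ?Q" for A
    using that by (auto simp: quotient_monoid_def carrier elim!: quotientE)
  have class_in_Q: "?r `` {s} \<in> carrier ?Q" if "s \<in> cofinite_isometries" for s
    using that by (simp add: quotient_monoid_def carrier quotientI)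
  have "h (A \<otimes>\<^bsub>?Q\<^esub> B) = h A + h B" if A: "A \<in> carrier ?Q" and B: "B \<in> carrier ?Q" for A B
  proof -
    obtain s t where s: "s \<in> cofinite_isometries" "A = ?r `` {s}"
      and t: "t \<in> cofinite_isometries" "B = ?r `` {t}"
      using Q[OF A] Q[OF B] by blast
    have "A \<otimes>\<^bsub>?Q\<^esub> B = ?r `` {t \<circ>\<^sub>m s}"
      using mult_quotient_IN_infinity[of s t] s t carrier by (simp add: IN_infinity_def)
    then show ?thesis
      using s t by (simp add: h cofinite_isometries_comp displacement_comp)
  qed
  then have "h \<in> hom ?Q integer_group" by (auto simp: hom_def)
  moreover have "inj_on h (carrier ?Q)"
  proof (rule inj_onI)
    fix A B assume A: "A \<in> carrier ?Q" and B: "B \<in> carrier ?Q" and eq: "h A = h B"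
    then obtain s t where s: "s \<in> cofinite_isometries" "A = ?r `` {s}"
      and t: "t \<in> cofinite_isometries" "B = ?r `` {t}"
      using Q[OF A] Q[OF B] by blast
    have "(s, t) \<in> ?r" using s t eq by (simp add: h least_group_congruence_iff_displacement)
    then show "A = B" using s(2) t(2) equiv_class_eq[OF equiv_least_group_congruence] by simp
  qed
  moreover have "h ` carrier ?Q = UNIV"
  proof -
    have "k \<in> h ` carrier ?Q" for k
    proof -
      obtain \<alpha> where "\<alpha> \<in> cofinite_isometries" "displacement \<alpha> = k"
        using displacement_surj .
      then show ?thesis using h class_in_Q by (metis imageI)
    qed
    then show ?thesis by blast
  qed
  ultimately show ?thesis by (auto intro!: is_isoI isoI simp: iso_def bij_betw_def)
qed

end
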